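(* Let $G$ be an ample groupoid and $A\subseteq G^{(0)}$ a compact open subset. Let $k>l>0$ be integers and suppose $A$ is $(G^a,k,l)$-paradoxical. Then $1_k\otimes 1_A$ is an infinite projection in $M_k(C_r^*(G))$.
   Context: Groupoids are locally compact Hausdorff with continuous product and inversion; $G^{(0)}$ is the unit space, $r(g)=gg^{-1}$, $d(g)=g^{-1}g$. $G$ is étale if $r,d$ are local homeomorphisms. A bisection is a subset $S\subseteq G$ such that $r|_S$ and $d|_S$ are homeomorphisms onto open subsets of $G$. An étale groupoid is ample if it has a basis of compact open bisections; $G^a$ is the set of compact open bisections. $C_r^*(G)$ is the reduced groupoid $C^*$-algebra, with $C_0(G^{(0)})\subseteq C_r^*(G)$ via extension by zero; $1_A$ is the characteristic function of $A$, and $1_k\otimes 1_A=\mathrm{diag}(1_A,\dots,1_A)\in M_k(C_r^*(G))$. A non-empty subset $A\subseteq G^{(0)}$ is $(G^a,k,l)$-paradoxical if for each $1\le i\le k$ there are $n_i\in\mathbb{N}$, bisections $V_{i,1},\dots,V_{i,n_i}\in G^a$ and $m_{i,1},\dots,m_{i,n_i}\in\{1,\dots,l\}$ such that $\bigcup_{j=1}^{n_i}d(V_{i,j})=A$ for all $i$, and the sets $r(V_{i,j})\times\{m_{i,j}\}\subseteq A\times\{1,\dots,l\}$ are pairwise disjoint. A projection $p$ in a $C^*$-algebra is infinite if there is a proper subprojection $q<p$ with $p\sim q$ (Murray–von Neumann equivalence). *)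

theory Defs
  imports "HOL-Analysis.Analysis"
begin

section \<open>Ample groupoids\<close>

text \<open>
  A groupoid in the algebraic form: a set of arrows with a partial associative product
  and an inversion.  The set of arrows is the underlying set of the topology.
\<close>

record 'g groupoid =
  gtop :: "'g topology"
  composable :: "('g \<times> 'g) set"
  prd :: "'g \<Rightarrow> 'g \<Rightarrow> 'g"
  ginv :: "'g \<Rightarrow> 'g"

abbreviation arrows :: "'g groupoid \<Rightarrow> 'g set" where
  "arrows G \<equiv> topspace (gtop G)"

definition groupoid :: "'g groupoid \<Rightarrow> bool" where
  "groupoid G \<longleftrightarrow>
     composable G \<subseteq> arrows G \<times> arrows G \<and>
     (\<forall>(g, h) \<in> composable G. prd G g h \<in> arrows G) \<and>
     (\<forall>g \<in> arrows G. ginv G g \<in> arrows G \<and> ginv G (ginv G g) = g) \<and>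
     (\<forall>g h k. (g, h) \<in> composable G \<and> (h, k) \<in> composable G \<longrightarrow>
        (prd G g h, k) \<in> composable G \<and> (g, prd G h k) \<in> composable G \<and>
        prd G (prd G g h) k = prd G g (prd G h k)) \<and>
     (\<forall>g \<in> arrows G. (ginv G g, g) \<in> composable G \<and> (g, ginv G g) \<in> composable G) \<and>
     (\<forall>(g, h) \<in> composable G.
        prd G (ginv G g) (prd G g h) = h \<and> prd G (prd G g h) (ginv G h) = g)"

definition grng :: "'g groupoid \<Rightarrow> 'g \<Rightarrow> 'g" where
  "grng G g = prd G g (ginv G g)"

definition gdom :: "'g groupoid \<Rightarrow> 'g \<Rightarrow> 'g" where
  "gdom G g = prd G (ginv G g) g"

definition unit_space :: "'g groupoid \<Rightarrow> 'g set" where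
  "unit_space G = grng G ` arrows G"

definition lch_groupoid :: "'g groupoid \<Rightarrow> bool" where
  "lch_groupoid G \<longleftrightarrow>
     groupoid G \<and> locally_compact_space (gtop G) \<and> Hausdorff_space (gtop G) \<and>
     continuous_map (subtopology (prod_topology (gtop G) (gtop G)) (composable G)) (gtop G)
       (\<lambda>(g, h). prd G g h) \<and>
     continuous_map (gtop G) (gtop G) (ginv G)"

definition homeo_onto_open :: "'a topology \<Rightarrow> 'b topology \<Rightarrow> ('a \<Rightarrow> 'b) \<Rightarrow> 'a set \<Rightarrow> bool" where
  "homeo_onto_open X Y f S \<longleftrightarrow>
     openin Y (f ` S) \<and> homeomorphic_map (subtopology X S) (subtopology Y (f ` S)) f"

definition local_homeo :: "'a topology \<Rightarrow> 'b topology \<Rightarrow> ('a \<Rightarrow> 'b) \<Rightarrow> bool" where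
  "local_homeo X Y f \<longleftrightarrow>
     (\<forall>x \<in> topspace X. \<exists>U. openin X U \<and> x \<in> U \<and> homeo_onto_open X Y f U)"

definition etale_groupoid :: "'g groupoid \<Rightarrow> bool" where
  "etale_groupoid G \<longleftrightarrow>
     lch_groupoid G \<and>
     local_homeo (gtop G) (gtop G) (grng G) \<and> local_homeo (gtop G) (gtop G) (gdom G)"

definition bisection :: "'g groupoid \<Rightarrow> 'g set \<Rightarrow> bool" where
  "bisection G S \<longleftrightarrow>
     S \<subseteq> arrows G \<and>
     homeo_onto_open (gtop G) (gtop G) (grng G) S \<and> homeo_onto_open (gtop G) (gtop G) (gdom G) S"

definition compact_open_bisections :: "'g groupoid \<Rightarrow> 'g set set" where
  "compact_open_bisections G =
     {S. bisection G S \<and> compactin (gtop G) S \<and> openin (gtop G) S}"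

definition ample_groupoid :: "'g groupoid \<Rightarrow> bool" where
  "ample_groupoid G \<longleftrightarrow>
     etale_groupoid G \<and>
     openin (gtop G) = arbitrary union_of (\<lambda>S. S \<in> compact_open_bisections G)"

text \<open>
  Disjointness is that of an indexed family: two different index pairs \<open>(i, j)\<close> must carry
  disjoint sets, even if the bisections and labels happen to coincide.
\<close>

definition paradoxical :: "'g groupoid \<Rightarrow> nat \<Rightarrow> nat \<Rightarrow> 'g set \<Rightarrow> bool" where
  "paradoxical G k l A \<longleftrightarrow>
     A \<noteq> {} \<and> A \<subseteq> unit_space G \<and>
     (\<exists>(n :: nat \<Rightarrow> nat) (V :: nat \<Rightarrow> nat \<Rightarrow> 'g set) (m :: nat \<Rightarrow> nat \<Rightarrow> nat).
        (\<forall>i \<in> {1..k}. \<forall>j \<in> {1..n i}. V i j \<in> compact_open_bisections G \<and> m i j \<in> {1..l}) \<and>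
        (\<forall>i \<in> {1..k}. (\<Union>j \<in> {1..n i}. gdom G ` V i j) = A) \<and>
        (\<forall>i \<in> {1..k}. \<forall>j \<in> {1..n i}. (grng G ` V i j) \<times> {m i j} \<subseteq> A \<times> {1..l}) \<and>
        disjoint_family_on (\<lambda>(i, j). (grng G ` V i j) \<times> {m i j}) (SIGMA i:{1..k}. {1..n i}))"


section \<open>The Hilbert space of square summable functions\<close>

typedef 'g ell2 = "{\<xi> :: 'g \<Rightarrow> complex. (\<lambda>g. (cmod (\<xi> g))\<^sup>2) summable_on UNIV}"
  morphisms ell2_fun Abs_ell2
  by (rule exI[of _ "\<lambda>_. 0"]) auto

setup_lifting type_definition_ell2

lemma ell2_prod_summable:
  fixes \<xi> \<eta> :: "'g \<Rightarrow> complex"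
  assumes "(\<lambda>g. (cmod (\<xi> g))\<^sup>2) summable_on UNIV" "(\<lambda>g. (cmod (\<eta> g))\<^sup>2) summable_on UNIV"
  shows "(\<lambda>g. \<xi> g * cnj (\<eta> g)) summable_on UNIV"
proof -
  have "(\<lambda>g. norm (\<xi> g * cnj (\<eta> g))) summable_on UNIV"
  proof (rule Infinite_Sum.abs_summable_product)
    show "(\<lambda>g. norm (\<xi> g * \<xi> g)) summable_on UNIV"
      using assms(1) by (simp add: norm_mult power2_eq_square)
    show "(\<lambda>g. norm (cnj (\<eta> g) * cnj (\<eta> g))) summable_on UNIV"
      using assms(2) by (simp add: norm_mult power2_eq_square)
  qed
  then show ?thesis by (rule Infinite_Sum.abs_summable_summable)
qed

lemma ell2_fun_prod_summable: "(\<lambda>g. ell2_fun \<xi> g * cnj (ell2_fun \<eta> g)) summable_on UNIV"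
  using ell2_fun[of \<xi>] ell2_fun[of \<eta>] by (intro ell2_prod_summable) auto

lemma ell2_add_summable:
  fixes \<xi> \<eta> :: "'g \<Rightarrow> complex"
  assumes "(\<lambda>g. (cmod (\<xi> g))\<^sup>2) summable_on UNIV" "(\<lambda>g. (cmod (\<eta> g))\<^sup>2) summable_on UNIV"
  shows "(\<lambda>g. (cmod (\<xi> g + \<eta> g))\<^sup>2) summable_on UNIV"
proof (rule summable_on_comparison_test)
  show "(\<lambda>g. 2 * (cmod (\<xi> g))\<^sup>2 + 2 * (cmod (\<eta> g))\<^sup>2) summable_on UNIV"
    by (intro summable_on_add summable_on_cmult_right assms)
  show "(cmod (\<xi> g + \<eta> g))\<^sup>2 \<le> 2 * (cmod (\<xi> g))\<^sup>2 + 2 * (cmod (\<eta> g))\<^sup>2" for g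
  proof -
    have "(cmod (\<xi> g + \<eta> g))\<^sup>2 \<le> (cmod (\<xi> g) + cmod (\<eta> g))\<^sup>2"
      by (simp add: norm_triangle_ineq power_mono)
    also have "\<dots> \<le> 2 * (cmod (\<xi> g))\<^sup>2 + 2 * (cmod (\<eta> g))\<^sup>2"
      using zero_le_power2[of "cmod (\<xi> g) - cmod (\<eta> g)"]
      by (simp add: power2_sum power2_diff)
    finally show ?thesis .
  qed
qed auto

lemma ell2_scale_summable:
  fixes \<xi> :: "'g \<Rightarrow> complex"
  assumes "(\<lambda>g. (cmod (\<xi> g))\<^sup>2) summable_on UNIV"
  shows "(\<lambda>g. (cmod (c * \<xi> g))\<^sup>2) summable_on UNIV"
  by (simp add: norm_mult power_mult_distrib summable_on_cmult_right assms)

instantiation ell2 :: (type) real_vector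
begin

lift_definition zero_ell2 :: "'a ell2" is "\<lambda>_. 0" by simp

lift_definition plus_ell2 :: "'a ell2 \<Rightarrow> 'a ell2 \<Rightarrow> 'a ell2" is "\<lambda>\<xi> \<eta> g. \<xi> g + \<eta> g"
  by (simp add: ell2_add_summable)

lift_definition uminus_ell2 :: "'a ell2 \<Rightarrow> 'a ell2" is "\<lambda>\<xi> g. - \<xi> g" by simp

lift_definition minus_ell2 :: "'a ell2 \<Rightarrow> 'a ell2 \<Rightarrow> 'a ell2" is "\<lambda>\<xi> \<eta> g. \<xi> g - \<eta> g"
  using ell2_add_summable[of _ "\<lambda>g. - _ g"] by fastforce

lift_definition scaleR_ell2 :: "real \<Rightarrow> 'a ell2 \<Rightarrow> 'a ell2" is "\<lambda>c \<xi> g. complex_of_real c * \<xi> g"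
  by (simp only: mem_Collect_eq ell2_scale_summable)

instance
  by standard (transfer; simp add: fun_eq_iff algebra_simps)+

end

definition ell2_cinner :: "'g ell2 \<Rightarrow> 'g ell2 \<Rightarrow> complex" where
  "ell2_cinner \<xi> \<eta> = (\<Sum>\<^sub>\<infinity>g. ell2_fun \<xi> g * cnj (ell2_fun \<eta> g))"

text \<open>
  The type-class inner product is real valued, so it is the real part of the complex one;
  both induce the usual norm.
\<close>

instantiation ell2 :: (type) real_inner
begin

definition inner_ell2 :: "'a ell2 \<Rightarrow> 'a ell2 \<Rightarrow> real" where
  "inner_ell2 \<xi> \<eta> = Re (ell2_cinner \<xi> \<eta>)"

definition norm_ell2 :: "'a ell2 \<Rightarrow> real" where
  "norm_ell2 \<xi> = sqrt (\<Sum>\<^sub>\<infinity>g. (cmod (ell2_fun \<xi> g))\<^sup>2)"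

definition dist_ell2 :: "'a ell2 \<Rightarrow> 'a ell2 \<Rightarrow> real" where
  "dist_ell2 \<xi> \<eta> = norm (\<xi> - \<eta>)"

definition sgn_ell2 :: "'a ell2 \<Rightarrow> 'a ell2" where
  "sgn_ell2 \<xi> = inverse (norm \<xi>) *\<^sub>R \<xi>"

definition uniformity_ell2 :: "('a ell2 \<times> 'a ell2) filter" where
  "uniformity_ell2 = (INF e\<in>{0<..}. principal {(\<xi>, \<eta>). dist \<xi> \<eta> < e})"

definition open_ell2 :: "'a ell2 set \<Rightarrow> bool" where
  "open_ell2 U \<longleftrightarrow> (\<forall>\<xi>\<in>U. eventually (\<lambda>(\<xi>', \<eta>). \<xi>' = \<xi> \<longrightarrow> \<eta> \<in> U) uniformity)"

instance
proof
  fix \<xi> \<eta> \<zeta> :: "'a ell2" and c :: real and U :: "'a ell2 set"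
  show "dist \<xi> \<eta> = norm (\<xi> - \<eta>)" by (simp add: dist_ell2_def)
  show "sgn \<xi> = inverse (norm \<xi>) *\<^sub>R \<xi>" by (simp add: sgn_ell2_def)
  show "(uniformity :: ('a ell2 \<times> 'a ell2) filter) =
      (INF e\<in>{0<..}. principal {(\<xi>, \<eta>). dist \<xi> \<eta> < e})"
    by (simp add: uniformity_ell2_def)
  show "open U = (\<forall>\<xi>\<in>U. eventually (\<lambda>(\<xi>', \<eta>). \<xi>' = \<xi> \<longrightarrow> \<eta> \<in> U) uniformity)"
    by (rule open_ell2_def)
  have "ell2_cinner \<eta> \<xi> = cnj (ell2_cinner \<xi> \<eta>)"
    unfolding ell2_cinner_def infsum_cnj[symmetric] by (simp add: mult.commute)
  then show "inner \<xi> \<eta> = inner \<eta> \<xi>" by (simp add: inner_ell2_def)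
  show "inner (\<xi> + \<eta>) \<zeta> = inner \<xi> \<zeta> + inner \<eta> \<zeta>"
    by (simp add: inner_ell2_def ell2_cinner_def plus_ell2.rep_eq distrib_right
        infsum_add ell2_fun_prod_summable)
  show "inner (c *\<^sub>R \<xi>) \<eta> = c * inner \<xi> \<eta>"
    by (simp add: inner_ell2_def ell2_cinner_def scaleR_ell2.rep_eq mult.assoc
        infsum_cmult_right')
  have sq: "(\<lambda>g. (cmod (ell2_fun \<xi> g))\<^sup>2) summable_on UNIV"
    using ell2_fun[of \<xi>] by simp
  have "inner \<xi> \<xi> = (\<Sum>\<^sub>\<infinity>g. Re (ell2_fun \<xi> g * cnj (ell2_fun \<xi> g)))"
    unfolding inner_ell2_def ell2_cinner_def by (rule infsum_Re[OF ell2_fun_prod_summable, symmetric])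
  also have "\<dots> = (\<Sum>\<^sub>\<infinity>g. (cmod (ell2_fun \<xi> g))\<^sup>2)"
    by (simp add: complex_mult_cnj cmod_power2)
  finally have inner_eq: "inner \<xi> \<xi> = (\<Sum>\<^sub>\<infinity>g. (cmod (ell2_fun \<xi> g))\<^sup>2)" .
  show "0 \<le> inner \<xi> \<xi>" unfolding inner_eq by (simp add: infsum_nonneg)
  show "norm \<xi> = sqrt (inner \<xi> \<xi>)" by (simp add: norm_ell2_def inner_eq)
  show "inner \<xi> \<xi> = 0 \<longleftrightarrow> \<xi> = 0"
  proof
    assume "inner \<xi> \<xi> = 0"
    then have "(cmod (ell2_fun \<xi> g))\<^sup>2 = 0" for g
      using nonneg_infsum_le_0D[OF _ sq] by (simp add: inner_eq)
    then have "ell2_fun \<xi> = ell2_fun 0" by (simp add: fun_eq_iff zero_ell2.rep_eq)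
    then show "\<xi> = 0" by (simp add: ell2_fun_inject)
  next
    assume "\<xi> = 0"
    then show "inner \<xi> \<xi> = 0" unfolding inner_eq by (simp add: zero_ell2.rep_eq)
  qed
qed

end

type_synonym 'g ell2_op = "'g ell2 \<Rightarrow>\<^sub>L 'g ell2"

text \<open>
  Adjoint with respect to the complex inner product.  It is unique when it exists; all the
  operators in the algebra below are complex linear and bounded and so have one.
\<close>

definition op_adj :: "'g ell2_op \<Rightarrow> 'g ell2_op" where
  "op_adj T = (THE S. \<forall>\<xi> \<eta>. ell2_cinner (blinfun_apply T \<xi>) \<eta> = ell2_cinner \<xi> (blinfun_apply S \<eta>))"


section \<open>Projections in star-algebras and matrix algebras\<close>

text \<open>
  Only product and involution enter the notions below.  Linear structure and norm are inherited
  from the ambient type; in particular the matrix algebra needs only the ambient addition.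
\<close>

record 'a star_alg =
  elems :: "'a set"
  mul :: "'a \<Rightarrow> 'a \<Rightarrow> 'a"
  star :: "'a \<Rightarrow> 'a"

definition projection :: "'a star_alg \<Rightarrow> 'a \<Rightarrow> bool" where
  "projection B p \<longleftrightarrow> p \<in> elems B \<and> mul B p p = p \<and> star B p = p"

definition proper_subprojection :: "'a star_alg \<Rightarrow> 'a \<Rightarrow> 'a \<Rightarrow> bool" where
  "proper_subprojection B q p \<longleftrightarrow>
     projection B q \<and> projection B p \<and> mul B p q = q \<and> mul B q p = q \<and> q \<noteq> p"

definition mvn_equiv :: "'a star_alg \<Rightarrow> 'a \<Rightarrow> 'a \<Rightarrow> bool" where
  "mvn_equiv B p q \<longleftrightarrow>
     (\<exists>v \<in> elems B. mul B (star B v) v = p \<and> mul B v (star B v) = q)"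

definition infinite_projection :: "'a star_alg \<Rightarrow> 'a \<Rightarrow> bool" where
  "infinite_projection B p \<longleftrightarrow>
     projection B p \<and> (\<exists>q. proper_subprojection B q p \<and> mvn_equiv B p q)"

text \<open>
  A \<open>k \<times> k\<close> matrix is a function on pairs of indices from \<open>{1..k}\<close>, extended by zero so
  that equality of matrices is equality of functions.
\<close>

definition mat_alg :: "nat \<Rightarrow> 'a::comm_monoid_add star_alg \<Rightarrow> (nat \<Rightarrow> nat \<Rightarrow> 'a) star_alg" where
  "mat_alg k B =
     \<lparr> elems = {M. \<forall>i j. if i \<in> {1..k} \<and> j \<in> {1..k} then M i j \<in> elems B else M i j = 0},
       mul = (\<lambda>M N i j. if i \<in> {1..k} \<and> j \<in> {1..k} then \<Sum>s = 1..k. mul B (M i s) (N s j) else 0),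
       star = (\<lambda>M i j. if i \<in> {1..k} \<and> j \<in> {1..k} then star B (M j i) else 0) \<rparr>"

definition diag_mat :: "nat \<Rightarrow> 'a::zero \<Rightarrow> nat \<Rightarrow> nat \<Rightarrow> 'a" where
  "diag_mat k a i j = (if i = j \<and> i \<in> {1..k} then a else 0)"


section \<open>The reduced C*-algebra\<close>

definition Cc :: "'g groupoid \<Rightarrow> ('g \<Rightarrow> complex) set" where
  "Cc G = {f. continuous_map (gtop G) euclidean f \<and>
              (\<forall>g. g \<notin> arrows G \<longrightarrow> f g = 0) \<and>
              compactin (gtop G) (gtop G closure_of {g. f g \<noteq> 0})}"

text \<open>
  For a unit \<open>x\<close> let \<open>G\<^sub>x\<close> be the set of arrows with domain \<open>x\<close>.  The regular representation of
  \<open>f \<in> Cc G\<close> on \<open>\<ell>\<^sup>2(G\<^sub>x)\<close> is \<open>(\<pi>\<^sub>x(f) \<xi>)(g) = \<Sum>h\<in>G\<^sub>x. f(g h\<^sup>-\<^sup>1) \<xi>(h)\<close>, and the reduced norm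
  is \<open>\<parallel>f\<parallel> = sup\<^sub>x \<parallel>\<pi>\<^sub>x(f)\<parallel>\<close>.  Since \<open>G\<close> is the disjoint union of the \<open>G\<^sub>x\<close>, the direct sum of all
  \<open>\<pi>\<^sub>x\<close> is the operator on \<open>\<ell>\<^sup>2(G)\<close> given by the same formula; its operator norm is the reduced
  norm, and the completion of \<open>Cc G\<close> is the operator norm closure of its image.  Here
  \<open>\<ell>\<^sup>2(G)\<close> is a summand of \<open>\<ell>\<^sup>2\<close> of the whole type; the operators vanish on the complement.
\<close>

definition convolve :: "'g groupoid \<Rightarrow> ('g \<Rightarrow> complex) \<Rightarrow> ('g \<Rightarrow> complex) \<Rightarrow> 'g \<Rightarrow> complex" where
  "convolve G f \<xi> g =
     (if g \<in> arrows G
      then \<Sum>\<^sub>\<infinity>h \<in> {h \<in> arrows G. gdom G h = gdom G g}. f (prd G g (ginv G h)) * \<xi> h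
      else 0)"

definition regular_rep :: "'g groupoid \<Rightarrow> ('g \<Rightarrow> complex) \<Rightarrow> 'g ell2_op" where
  "regular_rep G f = Blinfun (\<lambda>\<xi>. Abs_ell2 (convolve G f (ell2_fun \<xi>)))"

definition reduced_cstar :: "'g groupoid \<Rightarrow> 'g ell2_op star_alg" where
  "reduced_cstar G =
     \<lparr> elems = closure (regular_rep G ` Cc G), mul = (\<lambda>S T. S o\<^sub>L T), star = op_adj \<rparr>"

text \<open>The copy of the characteristic function of \<open>A \<subseteq> G\<^sup>(\<^sup>0\<^sup>)\<close>, extended by zero to \<open>G\<close>.\<close>

definition char_elem :: "'g groupoid \<Rightarrow> 'g set \<Rightarrow> 'g ell2_op" where
  "char_elem G A = regular_rep G (indicator A)"

end

theory Submission
  imports Defs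
begin

text \<open>
  The paradox is turned into one matrix \<open>v\<close> over the algebra whose two products \<open>v\<^sup>* v\<close> and
  \<open>v v\<^sup>*\<close> are diagonal and can be read off from the domains and the ranges of the bisections.

  Let \<open>V\<^sub>i\<^sub>j\<close> with labels \<open>m\<^sub>i\<^sub>j\<close> witness the paradox.  Removing from each \<open>V\<^sub>i\<^sub>j\<close> the arrows whose
  domain is already covered by some \<open>V\<^sub>i\<^sub>j'\<close> with \<open>j' < j\<close> leaves compact open bisections \<open>W\<^sub>i\<^sub>j\<close>
  whose domains partition \<open>A\<close> for each fixed \<open>i\<close>.  Let \<open>U\<^sub>s\<^sub>i\<close> be the union of the \<open>W\<^sub>i\<^sub>j\<close> with label
  \<open>m\<^sub>i\<^sub>j = s\<close>.  Its pieces have disjoint domains by construction and disjoint ranges by the paradox,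
  so \<open>r\<close> and \<open>d\<close> are injective on it; moreover
  \<^item> in each column \<open>i\<close>, the domains of the \<open>U\<^sub>s\<^sub>i\<close> partition \<open>A\<close>;
  \<^item> in each row \<open>s\<close>, the ranges of the \<open>U\<^sub>s\<^sub>i\<close> are disjoint subsets of \<open>A\<close>;
  \<^item> the last row is empty, because the labels are at most \<open>l < k\<close>.

  This is \<open>paradoxical_imp_matrix_of_bisections\<close>.  Put \<open>v\<^sub>s\<^sub>i = 1\<^bsub>U\<^sub>s\<^sub>i\<^esub>\<close>.  An entry of \<open>v\<^sup>* v\<close> off the
  diagonal is a sum of products \<open>1\<^sub>U\<^sup>* 1\<^bsub>U'\<^esub>\<close> with disjoint ranges, which vanish, and a diagonal entry
  is the sum of the \<open>1\<^sub>U\<^sup>* 1\<^sub>U = 1\<^bsub>d(U)\<^esub>\<close> over a column, which is \<open>1\<^sub>A\<close>.  In the same way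
  \<open>v v\<^sup>*\<close> is the diagonal matrix of the \<open>1\<^bsub>R(s)\<^esub>\<close>, where \<open>R(s) \<subseteq> A\<close> is the union of the ranges in
  row \<open>s\<close>.  Since \<open>R(k)\<close> is empty and \<open>A\<close> is not, \<open>v v\<^sup>*\<close> is a proper subprojection of
  \<open>v\<^sup>* v = 1\<^sub>k \<otimes> 1\<^sub>A\<close>.

  The operator identities are checked on \<open>\<ell>\<^sup>2\<close>: there \<open>1\<^sub>U\<close> acts as \<open>\<xi> \<mapsto> \<xi> \<circ> f\<close> for a partial
  injection \<open>f\<close>, namely left translation by the inverses of the arrows in \<open>U\<close>.  For such operators
  products and adjoints amount to composing and inverting partial injections.
\<close>

section \<open>Partial composition operators\<close>

text \<open>
  Functions on \<open>S\<close> stand for partial maps.  Only the case of \<open>f\<close> injective on \<open>S\<close> is meaningful,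
  since otherwise composition with \<open>f\<close> need not preserve square summability.
\<close>

definition pcomp :: "'g set \<Rightarrow> ('g \<Rightarrow> 'g) \<Rightarrow> 'g ell2_op" where
  "pcomp S f = Blinfun (\<lambda>\<xi>. Abs_ell2 (\<lambda>g. if g \<in> S then ell2_fun \<xi> (f g) else 0))"

lemma ell2_eqI:
  assumes "\<And>g. ell2_fun \<xi> g = ell2_fun \<eta> g"
  shows "\<xi> = \<eta>"
  using assms ell2_fun_inject by blast

lemma ell2_summable: "(\<lambda>g. (cmod (ell2_fun \<xi> g))\<^sup>2) summable_on B"
  using ell2_fun[of \<xi>] by (auto intro: summable_on_subset_banach)

lemma partial_reindex_has_sum:
  fixes \<phi> :: "'g \<Rightarrow> real"
  assumes "inj_on f S" and "\<phi> summable_on f ` S"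
  shows "((\<lambda>g. if g \<in> S then \<phi> (f g) else 0) has_sum infsum \<phi> (f ` S)) UNIV"
proof -
  have "(\<phi> has_sum infsum \<phi> (f ` S)) (f ` S)"
    using assms(2) by simp
  then have "((\<phi> \<circ> f) has_sum infsum \<phi> (f ` S)) S"
    using has_sum_reindex[OF assms(1)] by blast
  then show ?thesis
    by (rule has_sum_cong_neutral[THEN iffD1, rotated -1]) auto
qed

lemma pcomp_has_sum:
  assumes "inj_on f S"
  shows "((\<lambda>g. (cmod (if g \<in> S then ell2_fun \<xi> (f g) else 0))\<^sup>2) has_sum
    (\<Sum>\<^sub>\<infinity>h\<in>f ` S. (cmod (ell2_fun \<xi> h))\<^sup>2)) UNIV"
  using partial_reindex_has_sum[OF assms ell2_summable[of \<xi> "f ` S"]]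
  by (rule has_sum_cong[THEN iffD1, rotated]) auto

lemma pcomp_fun:
  assumes "inj_on f S"
  shows "ell2_fun (Abs_ell2 (\<lambda>g. if g \<in> S then ell2_fun \<xi> (f g) else 0)) =
    (\<lambda>g. if g \<in> S then ell2_fun \<xi> (f g) else 0)"
  using pcomp_has_sum[OF assms, of \<xi>]
  by (intro Abs_ell2_inverse) (auto simp: summable_on_def)

lemma bounded_linear_pcomp:
  fixes f :: "'g \<Rightarrow> 'g"
  assumes "inj_on f S"
  shows "bounded_linear (\<lambda>\<xi>. Abs_ell2 (\<lambda>g. if g \<in> S then ell2_fun \<xi> (f g) else 0))"
    (is "bounded_linear ?T")
proof (rule bounded_linear_intro[where K = 1])
  fix \<xi> \<eta> :: "'g ell2" and c :: real
  show "?T (\<xi> + \<eta>) = ?T \<xi> + ?T \<eta>"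
    by (rule ell2_eqI) (simp add: pcomp_fun[OF assms] plus_ell2.rep_eq)
  show "?T (c *\<^sub>R \<xi>) = c *\<^sub>R ?T \<xi>"
    by (rule ell2_eqI) (simp add: pcomp_fun[OF assms] scaleR_ell2.rep_eq)
  have "(\<Sum>\<^sub>\<infinity>g. (cmod (ell2_fun (?T \<xi>) g))\<^sup>2) = (\<Sum>\<^sub>\<infinity>h\<in>f ` S. (cmod (ell2_fun \<xi> h))\<^sup>2)"
    unfolding pcomp_fun[OF assms] using pcomp_has_sum[OF assms, of \<xi>] by (rule infsumI)
  also have "\<dots> \<le> (\<Sum>\<^sub>\<infinity>h. (cmod (ell2_fun \<xi> h))\<^sup>2)"
    by (rule infsum_mono_neutral) (auto intro: ell2_summable)
  finally show "norm (?T \<xi>) \<le> norm \<xi> * 1"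
    by (simp add: norm_ell2_def)
qed

lemma pcomp_apply:
  assumes "inj_on f S"
  shows "ell2_fun (blinfun_apply (pcomp S f) \<xi>) g = (if g \<in> S then ell2_fun \<xi> (f g) else 0)"
  by (simp add: pcomp_def bounded_linear_Blinfun_apply[OF bounded_linear_pcomp[OF assms]]
      pcomp_fun[OF assms])

lemma pcomp_cong:
  assumes "S = S'" and "\<And>g. g \<in> S' \<Longrightarrow> f g = f' g"
  shows "pcomp S f = pcomp S' f'"
  unfolding pcomp_def using assms by (intro arg_cong[of _ _ Blinfun] ext arg_cong[of _ _ Abs_ell2]) auto

lemma pcomp_empty: "pcomp {} f = 0"
  by (intro blinfun_eqI ell2_eqI) (simp add: pcomp_apply zero_ell2.rep_eq)

lemma pcomp_compose:
  assumes "inj_on f S" and "inj_on f' S'"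
  shows "pcomp S f o\<^sub>L pcomp S' f' = pcomp {g \<in> S. f g \<in> S'} (\<lambda>g. f' (f g))"
proof (intro blinfun_eqI ell2_eqI)
  fix \<xi> g
  have "inj_on (\<lambda>g. f' (f g)) {g \<in> S. f g \<in> S'}"
    using assms unfolding inj_on_def by simp
  then show "ell2_fun (blinfun_apply (pcomp S f o\<^sub>L pcomp S' f') \<xi>) g =
      ell2_fun (blinfun_apply (pcomp {g \<in> S. f g \<in> S'} (\<lambda>g. f' (f g))) \<xi>) g"
    by (simp add: pcomp_apply assms)
qed

text \<open>
  Adjoints are unique already because the real part of the complex inner product is nondegenerate.
\<close>

lemma op_adj_eqI:
  assumes "\<And>\<xi> \<eta>. ell2_cinner (blinfun_apply T \<xi>) \<eta> = ell2_cinner \<xi> (blinfun_apply S \<eta>)"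
  shows "op_adj T = S"
  unfolding op_adj_def
proof (rule the_equality)
  show "\<forall>\<xi> \<eta>. ell2_cinner (blinfun_apply T \<xi>) \<eta> = ell2_cinner \<xi> (blinfun_apply S \<eta>)"
    using assms by blast
next
  fix S'
  assume S': "\<forall>\<xi> \<eta>. ell2_cinner (blinfun_apply T \<xi>) \<eta> = ell2_cinner \<xi> (blinfun_apply S' \<eta>)"
  show "S' = S"
  proof (rule blinfun_eqI)
    fix \<eta>
    have "inner \<xi> (blinfun_apply S' \<eta>) = inner \<xi> (blinfun_apply S \<eta>)" for \<xi>
      using assms[of \<xi> \<eta>] S' by (simp add: inner_ell2_def)
    then show "blinfun_apply S' \<eta> = blinfun_apply S \<eta>"
      by (metis vector_eq_rdot inner_commute)
  qed
qed

text \<open>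
  Reindexing the sum that defines the inner product along the bijection \<open>f\<close> from \<open>S\<close> to its image
  moves \<open>f\<close> to the other argument as its inverse; so these operators are partial isometries.
\<close>

lemma op_adj_pcomp:
  assumes f: "inj_on f S"
  shows "op_adj (pcomp S f) = pcomp (f ` S) (inv_into S f)"
proof (rule op_adj_eqI)
  fix \<xi> \<eta>
  have "ell2_cinner (blinfun_apply (pcomp S f) \<xi>) \<eta> =
      (\<Sum>\<^sub>\<infinity>g\<in>S. ell2_fun \<xi> (f g) * cnj (ell2_fun \<eta> g))"
    unfolding ell2_cinner_def by (rule infsum_cong_neutral) (auto simp: pcomp_apply[OF f])
  also have "\<dots> = (\<Sum>\<^sub>\<infinity>g\<in>S. ((\<lambda>h. ell2_fun \<xi> h * cnj (ell2_fun \<eta> (inv_into S f h))) \<circ> f) g)"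
    by (rule infsum_cong) (simp add: inv_into_f_f[OF f])
  also have "\<dots> = (\<Sum>\<^sub>\<infinity>h\<in>f ` S. ell2_fun \<xi> h * cnj (ell2_fun \<eta> (inv_into S f h)))"
    by (rule infsum_reindex[OF f, symmetric])
  also have "\<dots> = ell2_cinner \<xi> (blinfun_apply (pcomp (f ` S) (inv_into S f)) \<eta>)"
    unfolding ell2_cinner_def
    by (rule infsum_cong_neutral) (auto simp: pcomp_apply[OF inj_on_inv_into[OF order_refl]])
  finally show "ell2_cinner (blinfun_apply (pcomp S f) \<xi>) \<eta> =
      ell2_cinner \<xi> (blinfun_apply (pcomp (f ` S) (inv_into S f)) \<eta>)" .
qed

lemma adj_pcomp_compose:
  assumes "inj_on f S" and "inj_on f' S'"
  shows "op_adj (pcomp S f) o\<^sub>L pcomp S' f' =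
    pcomp {h \<in> f ` S. inv_into S f h \<in> S'} (\<lambda>h. f' (inv_into S f h))"
  by (simp add: op_adj_pcomp[OF assms(1)] pcomp_compose[OF inj_on_inv_into[OF order_refl] assms(2)])

lemma pcomp_compose_adj:
  assumes "inj_on f S" and "inj_on f' S'"
  shows "pcomp S f o\<^sub>L op_adj (pcomp S' f') =
    pcomp {g \<in> S. f g \<in> f' ` S'} (\<lambda>g. inv_into S' f' (f g))"
  by (simp add: op_adj_pcomp[OF assms(2)] pcomp_compose[OF assms(1) inj_on_inv_into[OF order_refl]])


section \<open>Algebra of arrows\<close>

lemma groupoid_inv:
  assumes "groupoid G" and "g \<in> arrows G"
  shows "ginv G g \<in> arrows G" and "ginv G (ginv G g) = g"
    and "(ginv G g, g) \<in> composable G" and "(g, ginv G g) \<in> composable G"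
  using assms unfolding groupoid_def by auto

lemma groupoid_cancel:
  assumes "groupoid G" and "(g, h) \<in> composable G"
  shows "prd G (ginv G g) (prd G g h) = h" and "prd G (prd G g h) (ginv G h) = g"
  using assms unfolding groupoid_def by auto

lemma groupoid_closed:
  assumes "groupoid G" and "(g, h) \<in> composable G"
  shows "g \<in> arrows G" and "h \<in> arrows G" and "prd G g h \<in> arrows G"
  using assms unfolding groupoid_def by auto

lemma groupoid_assoc:
  assumes "groupoid G" and "(g, h) \<in> composable G" and "(h, k) \<in> composable G"
  shows "(prd G g h, k) \<in> composable G" and "(g, prd G h k) \<in> composable G"
    and "prd G (prd G g h) k = prd G g (prd G h k)"
  using assms unfolding groupoid_def by blast+

lemma range_mult_left:
  assumes "groupoid G" and "g \<in> arrows G"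
  shows "prd G (grng G g) g = g"
  using groupoid_cancel(2)[OF assms(1) groupoid_inv(4)[OF assms]] groupoid_inv(2)[OF assms]
  by (simp add: grng_def)

text \<open>
  From the cancellation axioms: for composable \<open>g\<close> and \<open>h\<close>, the product \<open>g\<^sup>-\<^sup>1 g h h\<^sup>-\<^sup>1\<close> collapses to
  \<open>g\<^sup>-\<^sup>1 g\<close> in one way and to \<open>h h\<^sup>-\<^sup>1\<close> in the other.
  Conversely \<open>g\<close> is composable with the unit \<open>g\<^sup>-\<^sup>1 g\<close>, hence with \<open>(h h\<^sup>-\<^sup>1) h = h\<close>.
\<close>

lemma composable_iff:
  assumes G: "groupoid G" and "g \<in> arrows G" and "h \<in> arrows G"
  shows "(g, h) \<in> composable G \<longleftrightarrow> gdom G g = grng G h"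
proof
  assume gh: "(g, h) \<in> composable G"
  have g': "(ginv G g, g) \<in> composable G"
    using groupoid_inv(3)[OF G assms(2)] .
  have "(prd G (ginv G g) g, h) \<in> composable G"
    using groupoid_assoc(1)[OF G g' gh] .
  then have "prd G (prd G (prd G (ginv G g) g) h) (ginv G h) = prd G (ginv G g) g"
    by (rule groupoid_cancel(2)[OF G])
  then show "gdom G g = grng G h"
    using groupoid_assoc(3)[OF G g' gh] groupoid_cancel(1)[OF G gh]
    by (simp add: gdom_def grng_def)
next
  assume eq: "gdom G g = grng G h"
  have "(g, grng G h) \<in> composable G"
    using groupoid_assoc(2)[OF G groupoid_inv(4)[OF G assms(2)] groupoid_inv(3)[OF G assms(2)]]
    by (simp add: eq[symmetric] gdom_def)
  moreover have "(grng G h, h) \<in> composable G"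
    using groupoid_assoc(1)[OF G groupoid_inv(4)[OF G assms(3)] groupoid_inv(3)[OF G assms(3)]]
    by (simp add: grng_def)
  ultimately have "(g, prd G (grng G h) h) \<in> composable G"
    by (rule groupoid_assoc(2)[OF G])
  then show "(g, h) \<in> composable G"
    by (simp add: range_mult_left[OF G assms(3)])
qed

lemma range_dom_inv:
  assumes "groupoid G" and "g \<in> arrows G"
  shows "grng G (ginv G g) = gdom G g" and "gdom G (ginv G g) = grng G g"
  by (simp_all add: grng_def gdom_def groupoid_inv(2)[OF assms])

lemma range_dom_prd:
  assumes G: "groupoid G" and gh: "(g, h) \<in> composable G"
  shows "grng G (prd G g h) = grng G g" and "gdom G (prd G g h) = gdom G h"
proof -
  note ar = groupoid_closed[OF G gh]
  have "(ginv G g, prd G g h) \<in> composable G"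
    using groupoid_assoc(2)[OF G groupoid_inv(3)[OF G ar(1)] gh] .
  then show "grng G (prd G g h) = grng G g"
    by (simp add: composable_iff[OF G] groupoid_inv(1)[OF G] ar range_dom_inv[OF G])
  have "(prd G g h, ginv G h) \<in> composable G"
    using groupoid_assoc(1)[OF G gh groupoid_inv(4)[OF G ar(2)]] .
  then show "gdom G (prd G g h) = gdom G h"
    by (simp add: composable_iff[OF G] groupoid_inv(1)[OF G] ar range_dom_inv[OF G])
qed

lemma unit_simps:
  assumes "groupoid G" and "x \<in> unit_space G"
  shows "x \<in> arrows G" and "grng G x = x" and "gdom G x = x"
proof -
  obtain g where g: "g \<in> arrows G" "x = prd G g (ginv G g)"
    using assms(2) by (auto simp: unit_space_def grng_def)
  note gg = groupoid_inv(4)[OF assms(1) g(1)]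
  show "x \<in> arrows G"
    using groupoid_closed(3)[OF assms(1) gg] g by simp
  show "grng G x = x"
    using range_dom_prd(1)[OF assms(1) gg] g by (simp add: grng_def)
  show "gdom G x = x"
    using range_dom_prd(2)[OF assms(1) gg] range_dom_inv(2)[OF assms(1) g(1)] g
    by (simp add: grng_def)
qed

lemma range_in_unit_space: "g \<in> arrows G \<Longrightarrow> grng G g \<in> unit_space G"
  by (simp add: unit_space_def)

lemma dom_in_unit_space:
  assumes "groupoid G" and "g \<in> arrows G"
  shows "gdom G g \<in> unit_space G"
  using range_in_unit_space[OF groupoid_inv(1)[OF assms]] range_dom_inv(1)[OF assms] by simp


section \<open>Operators of algebraic bisections\<close>

text \<open>
  The injectivity in the notion of a bisection.  It says that an arrow of \<open>U\<close> is determined by its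
  range and by its domain, so left translation by \<open>U\<close> is a partial injection.
\<close>

definition alg_bisection :: "'g groupoid \<Rightarrow> 'g set \<Rightarrow> bool" where
  "alg_bisection G U \<longleftrightarrow> U \<subseteq> arrows G \<and> inj_on (grng G) U \<and> inj_on (gdom G) U"

definition range_fibre :: "'g groupoid \<Rightarrow> 'g set \<Rightarrow> 'g set" where
  "range_fibre G D = {g \<in> arrows G. grng G g \<in> D}"

text \<open>
  Left translation by the inverse of the arrow of \<open>U\<close> with the same range as the argument; it maps
  the arrows with range in \<open>r(U)\<close> bijectively to those with range in \<open>d(U)\<close>.
\<close>

definition shift_back :: "'g groupoid \<Rightarrow> 'g set \<Rightarrow> 'g \<Rightarrow> 'g" where
  "shift_back G U g = prd G (ginv G (inv_into U (grng G) (grng G g))) g"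

lemma shift_back_eq:
  assumes "alg_bisection G U" and "w \<in> U" and "grng G g = grng G w"
  shows "shift_back G U g = prd G (ginv G w) g"
  using assms by (simp add: shift_back_def alg_bisection_def)

lemma shift_back_range_dom:
  assumes G: "groupoid G" and U: "alg_bisection G U"
    and w: "w \<in> U" and g: "g \<in> arrows G" and eq: "grng G g = grng G w"
  shows "shift_back G U g \<in> arrows G" and "grng G (shift_back G U g) = gdom G w"
    and "gdom G (shift_back G U g) = gdom G g" and "prd G w (shift_back G U g) = g"
proof -
  have wa: "w \<in> arrows G"
    using U w by (auto simp: alg_bisection_def)
  note inv = groupoid_inv[OF G wa] range_dom_inv[OF G wa]
  have comp: "(ginv G w, g) \<in> composable G"
    using g eq inv by (simp add: composable_iff[OF G])
  note sb = shift_back_eq[OF U w eq]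
  show "shift_back G U g \<in> arrows G" and "grng G (shift_back G U g) = gdom G w"
    and "gdom G (shift_back G U g) = gdom G g"
    using groupoid_closed(3)[OF G comp] range_dom_prd[OF G comp] inv by (simp_all add: sb)
  show "prd G w (shift_back G U g) = g"
    using groupoid_cancel(1)[OF G comp] inv by (simp add: sb)
qed

lemma inj_on_shift_back:
  assumes G: "groupoid G" and U: "alg_bisection G U"
  shows "inj_on (shift_back G U) (range_fibre G (grng G ` U))"
proof (rule inj_onI)
  fix g g'
  assume "g \<in> range_fibre G (grng G ` U)" "g' \<in> range_fibre G (grng G ` U)"
    and eq: "shift_back G U g = shift_back G U g'"
  then obtain w w' where w: "w \<in> U" "g \<in> arrows G" "grng G g = grng G w"
    and w': "w' \<in> U" "g' \<in> arrows G" "grng G g' = grng G w'"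
    by (auto simp: range_fibre_def)
  have "gdom G w = gdom G w'"
    using shift_back_range_dom(2)[OF G U w] shift_back_range_dom(2)[OF G U w'] eq by simp
  then have "w = w'"
    using U w(1) w'(1) by (auto simp: alg_bisection_def dest: inj_onD)
  then show "g = g'"
    using shift_back_range_dom(4)[OF G U w] shift_back_range_dom(4)[OF G U w'] eq by metis
qed

lemma shift_back_image:
  assumes G: "groupoid G" and U: "alg_bisection G U"
  shows "shift_back G U ` range_fibre G (grng G ` U) = range_fibre G (gdom G ` U)"
proof (intro equalityI subsetI)
  fix h
  assume "h \<in> shift_back G U ` range_fibre G (grng G ` U)"
  then obtain g w where "w \<in> U" "g \<in> arrows G" "grng G g = grng G w" "h = shift_back G U g"
    by (auto simp: range_fibre_def)
  then show "h \<in> range_fibre G (gdom G ` U)"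
    using shift_back_range_dom(1,2)[OF G U] by (simp add: range_fibre_def)
next
  fix h
  assume "h \<in> range_fibre G (gdom G ` U)"
  then obtain w where w: "w \<in> U" "h \<in> arrows G" "grng G h = gdom G w"
    by (auto simp: range_fibre_def)
  have wa: "w \<in> arrows G"
    using U w(1) by (auto simp: alg_bisection_def)
  then have comp: "(w, h) \<in> composable G"
    using w by (simp add: composable_iff[OF G])
  have rw: "grng G (prd G w h) = grng G w"
    by (rule range_dom_prd(1)[OF G comp])
  have "shift_back G U (prd G w h) = h"
    using shift_back_eq[OF U w(1) rw] groupoid_cancel(1)[OF G comp] by simp
  moreover have "prd G w h \<in> range_fibre G (grng G ` U)"
    using groupoid_closed(3)[OF G comp] rw w(1) by (simp add: range_fibre_def)
  ultimately show "h \<in> shift_back G U ` range_fibre G (grng G ` U)"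
    by (metis imageI)
qed

text \<open>
  In the convolution sum at \<open>g\<close>, a term \<open>h\<close> survives only if \<open>g h\<^sup>-\<^sup>1\<close> is some \<open>w \<in> U\<close>.  Then
  \<open>r(w) = r(g)\<close>, so injectivity of \<open>r\<close> on \<open>U\<close> determines \<open>w\<close>, and \<open>h = w\<^sup>-\<^sup>1 g\<close> is the only term.
\<close>

lemma convolve_indicator:
  assumes G: "groupoid G" and U: "alg_bisection G U"
  shows "convolve G (indicator U) \<xi> g =
    (if g \<in> range_fibre G (grng G ` U) then \<xi> (shift_back G U g) else 0)"
proof -
  have key: "w = prd G g (ginv G h) \<longleftrightarrow> grng G g = grng G w \<and> h = shift_back G U g"
    if g: "g \<in> arrows G" and h: "h \<in> arrows G" "gdom G h = gdom G g" and w: "w \<in> U" for g h w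
  proof -
    note ih = groupoid_inv[OF G h(1)] range_dom_inv[OF G h(1)]
    have comp: "(g, ginv G h) \<in> composable G"
      using g h ih by (simp add: composable_iff[OF G])
    show ?thesis
    proof
      assume eq: "w = prd G g (ginv G h)"
      have r: "grng G g = grng G w"
        using range_dom_prd(1)[OF G comp] eq by simp
      have "prd G w h = g"
        using groupoid_cancel(2)[OF G comp] ih eq by simp
      moreover have "(w, h) \<in> composable G"
        using groupoid_assoc(1)[OF G comp ih(3)] eq by simp
      ultimately have "prd G (ginv G w) g = h"
        using groupoid_cancel(1)[OF G] by blast
      then show "grng G g = grng G w \<and> h = shift_back G U g"
        using shift_back_eq[OF U w r] r by simp
    next
      assume "grng G g = grng G w \<and> h = shift_back G U g"
      then have r: "grng G g = grng G w" and h_eq: "h = shift_back G U g" by auto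
      note s = shift_back_range_dom[OF G U w g r]
      have wa: "w \<in> arrows G"
        using U w by (auto simp: alg_bisection_def)
      have "(w, h) \<in> composable G"
        using wa h(1) s h_eq by (simp add: composable_iff[OF G])
      then show "w = prd G g (ginv G h)"
        using groupoid_cancel(2)[OF G] s(4) h_eq by metis
    qed
  qed
  show ?thesis
  proof (cases "g \<in> range_fibre G (grng G ` U)")
    case True
    then obtain w where w: "w \<in> U" "g \<in> arrows G" "grng G g = grng G w"
      by (auto simp: range_fibre_def)
    note s = shift_back_range_dom[OF G U w]
    have "(\<Sum>\<^sub>\<infinity>h \<in> {h \<in> arrows G. gdom G h = gdom G g}.
          indicator U (prd G g (ginv G h)) * \<xi> h) = (\<Sum>\<^sub>\<infinity>h \<in> {shift_back G U g}. \<xi> h)"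
    proof (rule infsum_cong_neutral)
      fix h
      assume "h \<in> {h \<in> arrows G. gdom G h = gdom G g} - {shift_back G U g}"
      then have "prd G g (ginv G h) \<notin> U"
        using key[OF w(2)] by blast
      then show "indicator U (prd G g (ginv G h)) * \<xi> h = 0" by simp
    next
      fix h
      assume "h \<in> {h \<in> arrows G. gdom G h = gdom G g} \<inter> {shift_back G U g}"
      then have "prd G g (ginv G h) \<in> U"
        using key[OF w(2) _ _ w(1)] w by auto
      then show "indicator U (prd G g (ginv G h)) * \<xi> h = \<xi> h" by simp
    qed (use s in auto)
    then show ?thesis
      using True w(2) by (simp add: convolve_def)
  next
    case False
    have "(\<Sum>\<^sub>\<infinity>h \<in> {h \<in> arrows G. gdom G h = gdom G g}.
          indicator U (prd G g (ginv G h)) * \<xi> h) = 0" if g: "g \<in> arrows G"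
    proof (rule infsum_0)
      fix h
      assume "h \<in> {h \<in> arrows G. gdom G h = gdom G g}"
      then have "prd G g (ginv G h) \<notin> U"
        using key[OF g, of h] False g by (auto simp: range_fibre_def)
      then show "indicator U (prd G g (ginv G h)) * \<xi> h = 0" by simp
    qed
    then show ?thesis
      using False by (simp add: convolve_def)
  qed
qed

lemma regular_rep_indicator:
  assumes "groupoid G" and "alg_bisection G U"
  shows "regular_rep G (indicator U) = pcomp (range_fibre G (grng G ` U)) (shift_back G U)"
  unfolding regular_rep_def pcomp_def
  by (intro arg_cong[of _ _ Blinfun] ext arg_cong[of _ _ Abs_ell2]) (rule convolve_indicator[OF assms])

lemma alg_bisection_units:
  assumes "groupoid G" and "D \<subseteq> unit_space G"
  shows "alg_bisection G D" and "grng G ` D = D" and "gdom G ` D = D"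
proof -
  have D: "x \<in> arrows G" "grng G x = x" "gdom G x = x" if "x \<in> D" for x
    using unit_simps[OF assms(1)] assms(2) that by blast+
  then show "alg_bisection G D" "grng G ` D = D" "gdom G ` D = D"
    by (auto simp: alg_bisection_def inj_on_def)
qed

text \<open>
  Translation by a unit is the identity, so subsets of the unit space act by restricting functions
  to the arrows with range in the subset.
\<close>

lemma char_elem_eq_pcomp:
  assumes G: "groupoid G" and D: "D \<subseteq> unit_space G"
  shows "char_elem G D = pcomp (range_fibre G D) (\<lambda>g. g)"
  unfolding char_elem_def regular_rep_indicator[OF G alg_bisection_units(1)[OF assms]]
    alg_bisection_units(2)[OF assms]
proof (rule pcomp_cong)
  fix g
  assume "g \<in> range_fibre G D"
  then have g: "g \<in> arrows G" "grng G g \<in> D"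
    by (auto simp: range_fibre_def)
  then have u: "grng G g \<in> unit_space G" using D by blast
  note us = unit_simps[OF G u]
  show "shift_back G D g = g"
    using shift_back_range_dom(4)[OF G alg_bisection_units(1)[OF assms] g(2) g(1)] us
      range_mult_left[OF G shift_back_range_dom(1)[OF G alg_bisection_units(1)[OF assms] g(2) g(1)]]
      shift_back_range_dom(2)[OF G alg_bisection_units(1)[OF assms] g(2) g(1)]
    by simp
qed simp

text \<open>
  Translating by \<open>U\<close> and back is the identity on the arrows with range in \<open>d(U)\<close>; in the other order
  it is the identity on those with range in \<open>r(U)\<close>.
\<close>

lemma bisection_star_mul:
  assumes G: "groupoid G" and U: "alg_bisection G U"
  shows "op_adj (regular_rep G (indicator U)) o\<^sub>L regular_rep G (indicator U) = char_elem G (gdom G ` U)"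
proof -
  have sub: "gdom G ` U \<subseteq> unit_space G"
    using U dom_in_unit_space[OF G] by (auto simp: alg_bisection_def)
  show ?thesis
    unfolding regular_rep_indicator[OF assms] char_elem_eq_pcomp[OF G sub]
      adj_pcomp_compose[OF inj_on_shift_back[OF assms] inj_on_shift_back[OF assms]]
    by (rule pcomp_cong) (auto simp: shift_back_image[OF assms, symmetric] f_inv_into_f inv_into_into)
qed

lemma bisection_mul_star:
  assumes G: "groupoid G" and U: "alg_bisection G U"
  shows "regular_rep G (indicator U) o\<^sub>L op_adj (regular_rep G (indicator U)) = char_elem G (grng G ` U)"
proof -
  have sub: "grng G ` U \<subseteq> unit_space G"
    using U by (intro image_subsetI range_in_unit_space) (auto simp: alg_bisection_def)
  show ?thesis
    unfolding regular_rep_indicator[OF assms] char_elem_eq_pcomp[OF G sub]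
      pcomp_compose_adj[OF inj_on_shift_back[OF assms] inj_on_shift_back[OF assms]]
    by (rule pcomp_cong) (blast, simp add: inv_into_f_f[OF inj_on_shift_back[OF assms]])
qed

text \<open>
  The arrows with range in \<open>r(U)\<close> and those with range in \<open>r(U')\<close> form disjoint sets, so the two
  partial injections have empty composite.
\<close>

lemma bisection_star_mul_disjoint:
  assumes G: "groupoid G" and U: "alg_bisection G U" and U': "alg_bisection G U'"
    and disj: "grng G ` U \<inter> grng G ` U' = {}"
  shows "op_adj (regular_rep G (indicator U)) o\<^sub>L regular_rep G (indicator U') = 0"
proof -
  have "{h \<in> shift_back G U ` range_fibre G (grng G ` U).
      inv_into (range_fibre G (grng G ` U)) (shift_back G U) h \<in> range_fibre G (grng G ` U')} = {}"
  proof -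
    have "range_fibre G (grng G ` U) \<inter> range_fibre G (grng G ` U') = {}"
      using disj by (auto simp: range_fibre_def)
    then show ?thesis
      using inv_into_into[of _ "shift_back G U" "range_fibre G (grng G ` U)"] by blast
  qed
  then show ?thesis
    unfolding regular_rep_indicator[OF G U] regular_rep_indicator[OF G U']
      adj_pcomp_compose[OF inj_on_shift_back[OF G U] inj_on_shift_back[OF G U']]
    by (simp only: pcomp_empty)
qed

lemma bisection_mul_star_disjoint:
  assumes G: "groupoid G" and U: "alg_bisection G U" and U': "alg_bisection G U'"
    and disj: "gdom G ` U \<inter> gdom G ` U' = {}"
  shows "regular_rep G (indicator U) o\<^sub>L op_adj (regular_rep G (indicator U')) = 0"
proof -
  have "{g \<in> range_fibre G (grng G ` U).
      shift_back G U g \<in> shift_back G U' ` range_fibre G (grng G ` U')} = {}"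
  proof -
    have "range_fibre G (gdom G ` U) \<inter> range_fibre G (gdom G ` U') = {}"
      using disj by (auto simp: range_fibre_def)
    then show ?thesis
      using shift_back_image[OF G U] shift_back_image[OF G U'] by blast
  qed
  then show ?thesis
    unfolding regular_rep_indicator[OF G U] regular_rep_indicator[OF G U']
      pcomp_compose_adj[OF inj_on_shift_back[OF G U] inj_on_shift_back[OF G U']]
    by (simp only: pcomp_empty)
qed

lemma char_elem_empty: "groupoid G \<Longrightarrow> char_elem G {} = 0"
  by (simp add: char_elem_eq_pcomp range_fibre_def pcomp_empty)

lemma char_elem_mul:
  assumes G: "groupoid G" and "D \<subseteq> unit_space G" and "E \<subseteq> unit_space G"
  shows "char_elem G D o\<^sub>L char_elem G E = char_elem G (D \<inter> E)"
proof -
  have "D \<inter> E \<subseteq> unit_space G" using assms by blast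
  then show ?thesis
    unfolding assms(2,3)[THEN char_elem_eq_pcomp[OF G]] char_elem_eq_pcomp[OF G \<open>D \<inter> E \<subseteq> unit_space G\<close>]
    by (subst pcomp_compose) (auto simp: range_fibre_def intro!: pcomp_cong)
qed

lemma char_elem_adj:
  assumes G: "groupoid G" and D: "D \<subseteq> unit_space G"
  shows "op_adj (char_elem G D) = char_elem G D"
  unfolding char_elem_eq_pcomp[OF assms]
  by (subst op_adj_pcomp) (auto intro!: pcomp_cong simp: inv_into_f_f[of "\<lambda>g. g"] inj_on_def)

lemma char_elem_add:
  assumes G: "groupoid G" and "D \<subseteq> unit_space G" and "E \<subseteq> unit_space G" and "D \<inter> E = {}"
  shows "char_elem G (D \<union> E) = char_elem G D + char_elem G E"
proof -
  have DE: "D \<union> E \<subseteq> unit_space G" using assms by blast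
  have "\<not> (g \<in> range_fibre G D \<and> g \<in> range_fibre G E)"
    and "g \<in> range_fibre G (D \<union> E) \<longleftrightarrow> g \<in> range_fibre G D \<or> g \<in> range_fibre G E" for g
    using assms(4) by (auto simp: range_fibre_def)
  then show ?thesis
    by (intro blinfun_eqI ell2_eqI)
      (auto simp: char_elem_eq_pcomp[OF G] assms(2,3) DE pcomp_apply blinfun.add_left plus_ell2.rep_eq)
qed

lemma char_elem_sum:
  assumes G: "groupoid G" and "finite I" and "\<And>s. s \<in> I \<Longrightarrow> D s \<subseteq> unit_space G"
    and "disjoint_family_on D I"
  shows "(\<Sum>s\<in>I. char_elem G (D s)) = char_elem G (\<Union>s\<in>I. D s)"
  using assms(2-4)
proof (induction I rule: finite_induct)
  case empty
  then show ?case by (simp add: char_elem_empty[OF G])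
next
  case (insert t I)
  have "D t \<inter> (\<Union>s\<in>I. D s) = {}"
    using insert.hyps insert.prems(2) by (auto simp: disjoint_family_on_def)
  moreover have "(\<Union>s\<in>I. D s) \<subseteq> unit_space G" "D t \<subseteq> unit_space G"
    using insert.prems(1) by auto
  moreover have "(\<Sum>s\<in>I. char_elem G (D s)) = char_elem G (\<Union>s\<in>I. D s)"
    using insert.prems by (intro insert.IH) (auto simp: disjoint_family_on_def)
  ultimately show ?case
    using insert.hyps by (simp add: char_elem_add[OF G])
qed

text \<open>
  A unit \<open>x\<close> of \<open>D\<close> is its own range, so the point mass at \<open>x\<close> is fixed.
\<close>

lemma char_elem_nonzero:
  assumes G: "groupoid G" and D: "D \<subseteq> unit_space G" and "D \<noteq> {}"
  shows "char_elem G D \<noteq> 0"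
proof
  assume z: "char_elem G D = 0"
  obtain x where x: "x \<in> D" using assms(3) by blast
  have xf: "x \<in> range_fibre G D"
    using unit_simps[OF G, of x] x D by (auto simp: range_fibre_def)
  have "(\<lambda>g. 1 :: real) summable_on {x}"
    by simp
  then have "(\<lambda>g. (cmod (if g = x then 1 else 0))\<^sup>2) summable_on UNIV"
    by (rule summable_on_cong_neutral[THEN iffD1, rotated -1]) auto
  then have "ell2_fun (Abs_ell2 (\<lambda>g. if g = x then 1 else 0)) x = 1"
    by (subst Abs_ell2_inverse) auto
  then have "ell2_fun (blinfun_apply (char_elem G D) (Abs_ell2 (\<lambda>g. if g = x then 1 else 0))) x = 1"
    using xf by (simp add: char_elem_eq_pcomp[OF G D] pcomp_apply)
  then show False
    by (simp add: z zero_ell2.rep_eq)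
qed


section \<open>Compact open sets\<close>

lemma continuous_dom_range:
  assumes "lch_groupoid G"
  shows "continuous_map (gtop G) (gtop G) (gdom G)" and "continuous_map (gtop G) (gtop G) (grng G)"
proof -
  have G: "groupoid G" and inv: "continuous_map (gtop G) (gtop G) (ginv G)"
    and prd: "continuous_map (subtopology (prod_topology (gtop G) (gtop G)) (composable G)) (gtop G)
       (\<lambda>(g, h). prd G g h)"
    using assms by (auto simp: lch_groupoid_def)
  have "continuous_map (gtop G) (subtopology (prod_topology (gtop G) (gtop G)) (composable G))
      (\<lambda>g. (ginv G g, g))"
    by (auto simp: continuous_map_in_subtopology groupoid_inv[OF G]
        intro: continuous_map_pairedI inv)
  from continuous_map_compose[OF this prd] show "continuous_map (gtop G) (gtop G) (gdom G)"
    by (simp add: o_def gdom_def[abs_def])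
  have "continuous_map (gtop G) (subtopology (prod_topology (gtop G) (gtop G)) (composable G))
      (\<lambda>g. (g, ginv G g))"
    by (auto simp: continuous_map_in_subtopology groupoid_inv[OF G]
        intro: continuous_map_pairedI inv)
  from continuous_map_compose[OF this prd] show "continuous_map (gtop G) (gtop G) (grng G)"
    by (simp add: o_def grng_def[abs_def])
qed

text \<open>
  Over an etale groupoid this class of sets is closed under the operations that cut and
  reassemble the bisections: finite unions, images under \<open>r\<close> and \<open>d\<close>, and removal of preimages.
\<close>

definition compact_open :: "'a topology \<Rightarrow> 'a set \<Rightarrow> bool" where
  "compact_open X S \<longleftrightarrow> compactin X S \<and> openin X S"

lemma compact_open_UN:
  assumes "finite I" and "\<And>i. i \<in> I \<Longrightarrow> compact_open X (S i)"
  shows "compact_open X (\<Union>i\<in>I. S i)"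
  using assms unfolding compact_open_def by (auto intro!: compactin_Union)

text \<open>
  Compact sets are closed because the space is Hausdorff, so \<open>U\<close> is clopen; hence its indicator is
  continuous and \<open>U\<close> is its own closed support.
\<close>

lemma indicator_in_reduced_cstar:
  assumes "lch_groupoid G" and "compact_open (gtop G) U"
  shows "regular_rep G (indicator U) \<in> elems (reduced_cstar G)"
proof -
  have H: "Hausdorff_space (gtop G)" and U: "compactin (gtop G) U" "openin (gtop G) U"
    using assms by (auto simp: lch_groupoid_def compact_open_def)
  then have cl: "closedin (gtop G) U"
    by (intro compactin_imp_closedin)
  have "continuous_map (gtop G) euclidean (indicator U :: 'a \<Rightarrow> complex)"
    unfolding continuous_map_def
  proof (intro conjI allI impI)
    fix B :: "complex set"
    have "{x \<in> topspace (gtop G). indicator U x \<in> B} =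
      (if 1 \<in> B then U else {}) \<union> (if 0 \<in> B then topspace (gtop G) - U else {})"
      using openin_subset[OF U(2)] by (auto simp: indicator_def split: if_splits)
    moreover have "openin (gtop G) (topspace (gtop G) - U)"
      using cl by (simp add: closedin_def)
    ultimately show "openin (gtop G) {x \<in> topspace (gtop G). indicator U x \<in> B}"
      using U(2) by auto
  qed auto
  moreover have "{g. indicator U g \<noteq> (0 :: complex)} = U"
    by (auto simp: indicator_def)
  ultimately have "indicator U \<in> Cc G"
    using U openin_subset[OF U(2)] cl by (auto simp: Cc_def closure_of_closedin indicator_def)
  then show ?thesis
    by (auto simp: reduced_cstar_def intro: closure_subset[THEN subsetD])
qed


text \<open>
  As a compact open subset of a Hausdorff space, \<open>B\<close> is clopen, and so is the preimage of its
  complement.  This keeps the bisections compact open when their domains are made disjoint.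
\<close>

lemma compact_open_restrict:
  assumes "Hausdorff_space Y" and "continuous_map X Y f"
    and "compact_open X V" and "compact_open Y B"
  shows "compact_open X {x \<in> V. f x \<notin> B}"
proof -
  have V: "compactin X V" "openin X V" and B: "compactin Y B" "openin Y B"
    using assms(3,4) by (auto simp: compact_open_def)
  have "openin Y (topspace Y - B)" "closedin Y (topspace Y - B)"
    using compactin_imp_closedin[OF assms(1) B(1)] B(2) by auto
  then have pre: "openin X {x \<in> topspace X. f x \<in> topspace Y - B}"
      "closedin X {x \<in> topspace X. f x \<in> topspace Y - B}"
    using assms(2) openin_continuous_map_preimage closedin_continuous_map_preimage by blast+
  have "{x \<in> V. f x \<notin> B} = V \<inter> {x \<in> topspace X. f x \<in> topspace Y - B}"
    using openin_subset[OF V(2)] continuous_map_image_subset_topspace[OF assms(2)] by auto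
  then show ?thesis
    using V pre compact_Int_closedin[OF V(1) pre(2)] by (simp add: compact_open_def openin_Int)
qed

lemma local_homeo_open_image:
  assumes "local_homeo X Y f" and "openin X S"
  shows "openin Y (f ` S)"
proof (subst openin_subopen, intro ballI)
  fix y
  assume "y \<in> f ` S"
  then obtain x where x: "x \<in> S" "y = f x" by blast
  then have "x \<in> topspace X"
    using openin_subset[OF assms(2)] by blast
  then obtain U where U: "openin X U" "x \<in> U" "openin Y (f ` U)"
      "homeomorphic_map (subtopology X U) (subtopology Y (f ` U)) f"
    using assms(1) by (auto simp: local_homeo_def homeo_onto_open_def)
  have "openin (subtopology X U) (S \<inter> U)"
    using assms(2) by (auto simp: openin_subtopology)
  then have "openin (subtopology Y (f ` U)) (f ` (S \<inter> U))"
    using homeomorphic_imp_open_map[OF U(4)] by (simp add: open_map_def)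
  then have "openin Y (f ` (S \<inter> U))"
    using U(3) openin_trans_full by blast
  then show "\<exists>T. openin Y T \<and> y \<in> T \<and> T \<subseteq> f ` S"
    using x U(2) by (intro exI[of _ "f ` (S \<inter> U)"]) auto
qed

lemma compact_open_dom_range:
  assumes "etale_groupoid G" and "compact_open (gtop G) S"
  shows "compact_open (gtop G) (gdom G ` S)" and "compact_open (gtop G) (grng G ` S)"
  using assms image_compactin continuous_dom_range local_homeo_open_image
  unfolding etale_groupoid_def compact_open_def by metis+

lemma compact_open_bisectionsD:
  assumes "V \<in> compact_open_bisections G"
  shows "compact_open (gtop G) V" and "alg_bisection G V"
proof -
  have V: "compactin (gtop G) V" "openin (gtop G) V" "V \<subseteq> arrows G"
    and h: "homeo_onto_open (gtop G) (gtop G) (grng G) V" "homeo_onto_open (gtop G) (gtop G) (gdom G) V"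
    using assms by (auto simp: compact_open_bisections_def bisection_def)
  show "compact_open (gtop G) V"
    using V by (simp add: compact_open_def)
  have "topspace (subtopology (gtop G) V) = V"
    using V by auto
  then show "alg_bisection G V"
    using h V(3) homeomorphic_imp_injective_map
    unfolding alg_bisection_def homeo_onto_open_def by metis
qed


section \<open>The matrix of bisections of a paradoxical set\<close>

text \<open>
  The row index \<open>s\<close> runs over the labels and the column index \<open>i\<close> over the copies of \<open>A\<close>.  Collecting
  all pieces with the same label in one set gives the matrix entries without multiplicities; labels
  above \<open>l\<close> do not occur, and this makes the last row empty.
\<close>

lemma paradoxical_imp_matrix_of_bisections:
  assumes etale: "etale_groupoid G" and "l < k" and par: "paradoxical G k l A"
  obtains U :: "nat \<Rightarrow> nat \<Rightarrow> 'g set" where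
    "\<And>s i. i \<in> {1..k} \<Longrightarrow> compact_open (gtop G) (U s i)"
    "\<And>s i. i \<in> {1..k} \<Longrightarrow> alg_bisection G (U s i)"
    "\<And>s i. i \<in> {1..k} \<Longrightarrow> grng G ` U s i \<subseteq> A"
    "\<And>i. i \<in> {1..k} \<Longrightarrow> (\<Union>s\<in>{1..k}. gdom G ` U s i) = A"
    "\<And>s t i. i \<in> {1..k} \<Longrightarrow> s \<noteq> t \<Longrightarrow> gdom G ` U s i \<inter> gdom G ` U t i = {}"
    "\<And>s i j. i \<in> {1..k} \<Longrightarrow> j \<in> {1..k} \<Longrightarrow> i \<noteq> j \<Longrightarrow> grng G ` U s i \<inter> grng G ` U s j = {}"
    "\<And>i. i \<in> {1..k} \<Longrightarrow> U k i = {}"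
proof -
  obtain n :: "nat \<Rightarrow> nat" and V :: "nat \<Rightarrow> nat \<Rightarrow> 'g set" and m :: "nat \<Rightarrow> nat \<Rightarrow> nat" where
    V: "\<forall>i \<in> {1..k}. \<forall>j \<in> {1..n i}. V i j \<in> compact_open_bisections G \<and> m i j \<in> {1..l}"
    and dV: "\<forall>i \<in> {1..k}. (\<Union>j \<in> {1..n i}. gdom G ` V i j) = A"
    and rV: "\<forall>i \<in> {1..k}. \<forall>j \<in> {1..n i}. (grng G ` V i j) \<times> {m i j} \<subseteq> A \<times> {1..l}"
    and disj: "disjoint_family_on (\<lambda>(i, j). (grng G ` V i j) \<times> {m i j}) (SIGMA i:{1..k}. {1..n i})"
    using par unfolding paradoxical_def by blast
  have G: "lch_groupoid G"
    using etale by (simp add: etale_groupoid_def)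
  then have H: "Hausdorff_space (gtop G)"
    by (simp add: lch_groupoid_def)
  \<comment> \<open>\<open>B i j\<close> is the part of \<open>A\<close> covered before step \<open>j\<close>; each unit keeps only the first piece
    whose domain contains it.\<close>
  define B where "B i j = (\<Union>j' \<in> {1..<j}. gdom G ` V i j')" for i j
  define W where "W i j = {g \<in> V i j. gdom G g \<notin> B i j}" for i j
  define J where "J s i = {j \<in> {1..n i}. m i j = s}" for s i
  define U where "U s i = (\<Union>j \<in> J s i. W i j)" for s i
  have W_sub: "W i j \<subseteq> V i j" for i j
    by (auto simp: W_def)
  have U_D: "\<exists>j. j \<in> {1..n i} \<and> m i j = s \<and> g \<in> W i j \<and> g \<in> V i j" if "g \<in> U s i" for g s i
    using that W_sub by (auto simp: U_def J_def)
  have W_open: "compact_open (gtop G) (W i j)" if i: "i \<in> {1..k}" and j: "j \<in> {1..n i}" for i j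
  proof -
    have "compact_open (gtop G) (B i j)"
      unfolding B_def using i j V
      by (intro compact_open_UN compact_open_dom_range(1)[OF etale] compact_open_bisectionsD(1)) auto
    then show ?thesis
      unfolding W_def using i j V
      by (blast intro: compact_open_restrict[OF H continuous_dom_range(1)[OF G]]
          compact_open_bisectionsD(1))
  qed
  have bis: "inj_on (grng G) (V i j)" "inj_on (gdom G) (V i j)" "V i j \<subseteq> arrows G"
    if "i \<in> {1..k}" "j \<in> {1..n i}" for i j
    using V that compact_open_bisectionsD(2)[of "V i j" G] by (auto simp: alg_bisection_def)
  have d_inj: "j = j'" if "i \<in> {1..k}" "j \<in> {1..n i}" "j' \<in> {1..n i}"
    "g \<in> W i j" "g' \<in> W i j'" "gdom G g = gdom G g'" for i j j' g g'
  proof (rule ccontr)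
    assume "j \<noteq> j'"
    then consider "j < j'" | "j' < j" by linarith
    then show False
    proof cases
      case 1
      moreover have "gdom G g \<in> gdom G ` V i j" using that(4) W_sub by blast
      ultimately have "gdom G g \<in> B i j'"
        unfolding B_def using that(2) by (intro UN_I[of j]) simp_all
      then show False using that by (simp add: W_def)
    next
      case 2
      moreover have "gdom G g' \<in> gdom G ` V i j'" using that(5) W_sub by blast
      ultimately have "gdom G g' \<in> B i j"
        unfolding B_def using that(3) by (intro UN_I[of j']) simp_all
      then show False using that by (simp add: W_def)
    qed
  qed
  have r_inj: "i = i' \<and> j = j'" if ij: "i \<in> {1..k}" "i' \<in> {1..k}" "j \<in> {1..n i}" "j' \<in> {1..n i'}"
    and mm: "m i j = m i' j'" and g: "g \<in> V i j" "g' \<in> V i' j'" "grng G g = grng G g'" for i i' j j' g g'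
  proof (rule ccontr)
    \<comment> \<open>The index pairs differ, so the labelled ranges are disjoint; but they share the point
      \<open>(r(g), m i j)\<close>.\<close>
    assume "\<not> (i = i' \<and> j = j')"
    then have "(grng G ` V i j \<times> {m i j}) \<inter> (grng G ` V i' j' \<times> {m i' j'}) = {}"
      using disjoint_family_onD[OF disj, of "(i, j)" "(i', j')"] ij by auto
    moreover have "(grng G g, m i j) \<in> grng G ` V i j \<times> {m i j}"
      using g(1) by blast
    moreover have "(grng G g, m i j) \<in> grng G ` V i' j' \<times> {m i' j'}"
      using imageI[OF g(2), of "grng G"] g(3) mm by simp
    ultimately show False by blast
  qed
  show thesis
  proof (rule that[of U])
    fix s i
    assume i: "i \<in> {1..k}"
    show "compact_open (gtop G) (U s i)"
      unfolding U_def using W_open[OF i] by (intro compact_open_UN) (auto simp: J_def)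
    have "inj_on (grng G) (U s i)"
    proof (rule inj_onI)
      fix g g'
      assume "g \<in> U s i" "g' \<in> U s i" and eq: "grng G g = grng G g'"
      then obtain j j' where j: "j \<in> {1..n i}" "m i j = s" "g \<in> V i j"
        and j': "j' \<in> {1..n i}" "m i j' = s" "g' \<in> V i j'"
        using U_D by meson
      then have "j = j'"
        using r_inj[OF i i j(1) j'(1) _ j(3) j'(3) eq] by simp
      then show "g = g'"
        using bis(1)[OF i j(1)] j j' eq by (auto dest: inj_onD)
    qed
    moreover have "inj_on (gdom G) (U s i)"
    proof (rule inj_onI)
      fix g g'
      assume "g \<in> U s i" "g' \<in> U s i" and eq: "gdom G g = gdom G g'"
      then obtain j j' where j: "j \<in> {1..n i}" "g \<in> W i j" and j': "j' \<in> {1..n i}" "g' \<in> W i j'"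
        using U_D by meson
      have "j = j'"
        by (rule d_inj[OF i j(1) j'(1) j(2) j'(2) eq])
      then show "g = g'"
        using bis(2)[OF i j(1)] W_sub j j' eq by (meson inj_onD subsetD)
    qed
    moreover have "U s i \<subseteq> arrows G"
      using bis(3)[OF i] W_sub by (fastforce simp: U_def J_def)
    ultimately show "alg_bisection G (U s i)"
      by (simp add: alg_bisection_def)
    show "grng G ` U s i \<subseteq> A"
    proof (rule image_subsetI)
      fix g
      assume "g \<in> U s i"
      then obtain j where j: "j \<in> {1..n i}" "g \<in> V i j"
        using U_D by meson
      then have "(grng G g, m i j) \<in> grng G ` V i j \<times> {m i j}" by auto
      then show "grng G g \<in> A" using rV i j(1) by blast
    qed
  next
    fix i
    assume i: "i \<in> {1..k}"
    show "(\<Union>s\<in>{1..k}. gdom G ` U s i) = A"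
    proof (intro equalityI subsetI)
      fix x
      assume "x \<in> (\<Union>s\<in>{1..k}. gdom G ` U s i)"
      then obtain j g where "j \<in> {1..n i}" "g \<in> V i j" "x = gdom G g"
        using U_D by blast
      then show "x \<in> A" using dV i by blast
    next
      fix x
      assume "x \<in> A"
      then have "\<exists>j. j \<in> {1..n i} \<and> x \<in> gdom G ` V i j"
        using dV i by blast
      then obtain j where j: "j \<in> {1..n i}" "x \<in> gdom G ` V i j"
        and least: "\<forall>j'<j. \<not> (j' \<in> {1..n i} \<and> x \<in> gdom G ` V i j')"
        by (subst (asm) exists_least_iff) blast
      obtain g where g: "g \<in> V i j" "x = gdom G g"
        using j(2) by blast
      have "x \<notin> gdom G ` V i j'" if "j' \<in> {1..<j}" for j'
        using least that j(1) by simp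
      then have "g \<in> W i j"
        using g by (auto simp: W_def B_def)
      then have "g \<in> U (m i j) i"
        using j(1) by (auto simp: U_def J_def)
      moreover have "m i j \<in> {1..k}"
        using V i j(1) \<open>l < k\<close> by fastforce
      ultimately show "x \<in> (\<Union>s\<in>{1..k}. gdom G ` U s i)"
        using g(2) by blast
    qed
    show "U k i = {}"
    proof -
      have "m i j \<noteq> k" if "j \<in> {1..n i}" for j
        using V i that \<open>l < k\<close> by fastforce
      then have "J k i = {}" by (simp add: J_def)
      then show ?thesis by (simp add: U_def)
    qed
  next
    fix s t i :: nat
    assume i: "i \<in> {1..k}" and "s \<noteq> t"
    show "gdom G ` U s i \<inter> gdom G ` U t i = {}"
    proof (rule ccontr)
      assume "\<not> ?thesis"
      then obtain g g' where "g \<in> U s i" "g' \<in> U t i" and eq: "gdom G g = gdom G g'"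
        by auto
      then obtain j j' where "j \<in> {1..n i}" "m i j = s" "g \<in> W i j"
        and "j' \<in> {1..n i}" "m i j' = t" "g' \<in> W i j'"
        using U_D by meson
      then show False
        using d_inj[OF i _ _ _ _ eq] \<open>s \<noteq> t\<close> by blast
    qed
  next
    fix s i i' :: nat
    assume i: "i \<in> {1..k}" "i' \<in> {1..k}" and "i \<noteq> i'"
    show "grng G ` U s i \<inter> grng G ` U s i' = {}"
    proof (rule ccontr)
      assume "\<not> ?thesis"
      then obtain g g' where "g \<in> U s i" "g' \<in> U s i'" and eq: "grng G g = grng G g'"
        by auto
      then obtain j j' where "j \<in> {1..n i}" "m i j = s" "g \<in> V i j"
        and "j' \<in> {1..n i'}" "m i' j' = s" "g' \<in> V i' j'"
        using U_D by meson
      then show False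
        using r_inj[OF i _ _ _ _ _ eq] \<open>i \<noteq> i'\<close> by metis
    qed
  qed
qed


section \<open>Diagonal matrices of characteristic functions\<close>

definition diag_chars :: "'g groupoid \<Rightarrow> nat \<Rightarrow> (nat \<Rightarrow> 'g set) \<Rightarrow> nat \<Rightarrow> nat \<Rightarrow> 'g ell2_op" where
  "diag_chars G k D i j = (if i = j \<and> i \<in> {1..k} then char_elem G (D i) else 0)"

lemma zero_in_reduced_cstar: "lch_groupoid G \<Longrightarrow> 0 \<in> elems (reduced_cstar G)"
  using indicator_in_reduced_cstar[of G "{}"] char_elem_empty[of G]
  by (simp add: compact_open_def char_elem_def lch_groupoid_def)

lemma diag_chars_mul:
  assumes G: "groupoid G" and D: "\<And>i. i \<in> {1..k} \<Longrightarrow> D i \<subseteq> unit_space G"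
    and E: "\<And>i. i \<in> {1..k} \<Longrightarrow> E i \<subseteq> unit_space G"
  shows "mul (mat_alg k (reduced_cstar G)) (diag_chars G k D) (diag_chars G k E) =
    diag_chars G k (\<lambda>i. D i \<inter> E i)"
proof (intro ext)
  fix i j
  have "(\<Sum>s = 1..k. diag_chars G k D i s o\<^sub>L diag_chars G k E s j) =
      (\<Sum>s = 1..k. if s = i then diag_chars G k (\<lambda>i. D i \<inter> E i) i j else 0)"
    if "i \<in> {1..k}" "j \<in> {1..k}"
    using that by (intro sum.cong) (auto simp: diag_chars_def char_elem_mul[OF G D E])
  then show "mul (mat_alg k (reduced_cstar G)) (diag_chars G k D) (diag_chars G k E) i j =
      diag_chars G k (\<lambda>i. D i \<inter> E i) i j"
    by (auto simp: mat_alg_def reduced_cstar_def diag_chars_def)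
qed

lemma diag_chars_projection:
  assumes G: "lch_groupoid G" and D: "\<And>i. i \<in> {1..k} \<Longrightarrow> D i \<subseteq> unit_space G"
    and "\<And>i. i \<in> {1..k} \<Longrightarrow> compact_open (gtop G) (D i)"
  shows "projection (mat_alg k (reduced_cstar G)) (diag_chars G k D)"
  unfolding projection_def
proof (intro conjI)
  have grp: "groupoid G"
    using G by (simp add: lch_groupoid_def)
  show "diag_chars G k D \<in> elems (mat_alg k (reduced_cstar G))"
    using indicator_in_reduced_cstar[OF G assms(3)] zero_in_reduced_cstar[OF G]
    by (auto simp: mat_alg_def diag_chars_def char_elem_def)
  show "mul (mat_alg k (reduced_cstar G)) (diag_chars G k D) (diag_chars G k D) = diag_chars G k D"
    using diag_chars_mul[OF grp D D] by simp
  have "op_adj (0 :: 'a ell2_op) = 0"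
    using char_elem_adj[OF grp, of "{}"] by (simp add: char_elem_empty[OF grp])
  then show "star (mat_alg k (reduced_cstar G)) (diag_chars G k D) = diag_chars G k D"
    by (intro ext) (auto simp: mat_alg_def reduced_cstar_def diag_chars_def char_elem_adj[OF grp D])
qed

theorem proposition4p11:
  fixes G :: "'g groupoid" and A :: "'g set" and k l :: nat
  assumes "ample_groupoid G"
    and "A \<subseteq> unit_space G"
    and "compactin (gtop G) A"
    and "openin (subtopology (gtop G) (unit_space G)) A"
    and "0 < l" and "l < k"
    and "paradoxical G k l A"
  shows "infinite_projection (mat_alg k (reduced_cstar G)) (diag_mat k (char_elem G A))"
proof -
  let ?B = "mat_alg k (reduced_cstar G)"
  have etale: "etale_groupoid G"
    using assms(1) by (simp add: ample_groupoid_def)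
  then have lch: "lch_groupoid G"
    by (simp add: etale_groupoid_def)
  then have G: "groupoid G"
    by (simp add: lch_groupoid_def)
  have A_ne: "A \<noteq> {}"
    using assms(7) by (simp add: paradoxical_def)
  have k: "k \<in> {1..k}"
    using assms(6) by simp
  obtain U :: "nat \<Rightarrow> nat \<Rightarrow> 'g set" where
    co: "\<And>s i. i \<in> {1..k} \<Longrightarrow> compact_open (gtop G) (U s i)"
    and bis: "\<And>s i. i \<in> {1..k} \<Longrightarrow> alg_bisection G (U s i)"
    and rA: "\<And>s i. i \<in> {1..k} \<Longrightarrow> grng G ` U s i \<subseteq> A"
    and dA: "\<And>i. i \<in> {1..k} \<Longrightarrow> (\<Union>s\<in>{1..k}. gdom G ` U s i) = A"
    and ddisj: "\<And>s t i. i \<in> {1..k} \<Longrightarrow> s \<noteq> t \<Longrightarrow> gdom G ` U s i \<inter> gdom G ` U t i = {}"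
    and rdisj: "\<And>s i j. i \<in> {1..k} \<Longrightarrow> j \<in> {1..k} \<Longrightarrow> i \<noteq> j \<Longrightarrow> grng G ` U s i \<inter> grng G ` U s j = {}"
    and Uk: "\<And>i. i \<in> {1..k} \<Longrightarrow> U k i = {}"
    by (rule paradoxical_imp_matrix_of_bisections[OF etale assms(6,7)]) blast
  define T where "T s i = regular_rep G (indicator (U s i))" for s i
  define v where "v s i = (if s \<in> {1..k} \<and> i \<in> {1..k} then T s i else 0)" for s i
  define R where "R s = (\<Union>i\<in>{1..k}. grng G ` U s i)" for s
  have RA: "R s \<subseteq> A" for s
    unfolding R_def by (intro UN_least rA)
  have p_eq: "diag_mat k (char_elem G A) = diag_chars G k (\<lambda>_. A)"
    by (intro ext) (simp add: diag_mat_def diag_chars_def)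
  have v: "v \<in> elems ?B"
    using indicator_in_reduced_cstar[OF lch co] by (auto simp: mat_alg_def v_def T_def)
  have star_v_v: "mul ?B (star ?B v) v = diag_chars G k (\<lambda>_. A)"
  proof (intro ext)
    fix i j
    have "(\<Sum>s = 1..k. op_adj (T s i) o\<^sub>L T s j) = diag_chars G k (\<lambda>_. A) i j"
      if ij: "i \<in> {1..k}" "j \<in> {1..k}"
    proof (cases "i = j")
      case True
      have "(\<Sum>s = 1..k. op_adj (T s i) o\<^sub>L T s j) = (\<Sum>s = 1..k. char_elem G (gdom G ` U s i))"
        unfolding T_def True by (intro sum.cong refl bisection_star_mul[OF G bis[OF ij(2)]])
      also have "\<dots> = char_elem G (\<Union>s\<in>{1..k}. gdom G ` U s i)"
      proof (rule char_elem_sum[OF G])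
        show "gdom G ` U s i \<subseteq> unit_space G" if "s \<in> {1..k}" for s
          using dA[OF ij(1)] that assms(2) by blast
        show "disjoint_family_on (\<lambda>s. gdom G ` U s i) {1..k}"
          using ddisj[OF ij(1)] by (simp add: disjoint_family_on_def)
      qed simp
      finally show ?thesis
        using dA[OF ij(1)] True ij by (simp add: diag_chars_def)
    next
      case False
      then have "op_adj (T s i) o\<^sub>L T s j = 0" for s
        unfolding T_def by (intro bisection_star_mul_disjoint G bis ij rdisj)
      then show ?thesis
        using False by (simp add: diag_chars_def)
    qed
    then show "mul ?B (star ?B v) v i j = diag_chars G k (\<lambda>_. A) i j"
      by (auto simp: mat_alg_def reduced_cstar_def v_def diag_chars_def)
  qed
  have v_star_v: "mul ?B v (star ?B v) = diag_chars G k R"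
  proof (intro ext)
    fix s t
    have "(\<Sum>i = 1..k. T s i o\<^sub>L op_adj (T t i)) = diag_chars G k R s t"
      if st: "s \<in> {1..k}" "t \<in> {1..k}"
    proof (cases "s = t")
      case True
      have "(\<Sum>i = 1..k. T s i o\<^sub>L op_adj (T t i)) = (\<Sum>i = 1..k. char_elem G (grng G ` U s i))"
        unfolding T_def True by (intro sum.cong refl bisection_mul_star[OF G bis])
      also have "\<dots> = char_elem G (R s)"
        unfolding R_def
      proof (rule char_elem_sum[OF G])
        show "grng G ` U s i \<subseteq> unit_space G" if "i \<in> {1..k}" for i
          using rA[OF that] assms(2) by blast
        show "disjoint_family_on (\<lambda>i. grng G ` U s i) {1..k}"
          using rdisj by (simp add: disjoint_family_on_def)
      qed simp
      finally show ?thesis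
        using True st by (simp add: diag_chars_def)
    next
      case False
      then have "T s i o\<^sub>L op_adj (T t i) = 0" if "i \<in> {1..k}" for i
        unfolding T_def by (intro bisection_mul_star_disjoint G bis that ddisj)
      then show ?thesis
        using False by (simp add: diag_chars_def)
    qed
    then show "mul ?B v (star ?B v) s t = diag_chars G k R s t"
      by (auto simp: mat_alg_def reduced_cstar_def v_def diag_chars_def)
  qed
  have A_open: "compact_open (gtop G) A"
  proof -
    have "compact_open (gtop G) (gdom G ` U s k)" for s
      by (intro compact_open_dom_range(1)[OF etale] co k)
    then show ?thesis
      using dA[OF k] compact_open_UN[of "{1..k}" "gtop G" "\<lambda>s. gdom G ` U s k"] by simp
  qed
  have R_open: "compact_open (gtop G) (R s)" for s
    unfolding R_def by (intro compact_open_UN compact_open_dom_range(2)[OF etale] co) simp_all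
  have R_units: "R s \<subseteq> unit_space G" for s
    using RA assms(2) by blast
  have "projection ?B (diag_chars G k (\<lambda>_. A))"
    by (rule diag_chars_projection[OF lch assms(2) A_open])
  moreover have "proper_subprojection ?B (diag_chars G k R) (diag_chars G k (\<lambda>_. A))"
    unfolding proper_subprojection_def
  proof (intro conjI)
    show "projection ?B (diag_chars G k R)" "projection ?B (diag_chars G k (\<lambda>_. A))"
      by (intro diag_chars_projection[OF lch] R_units R_open assms(2) A_open)+
    have "A \<inter> R s = R s" "R s \<inter> A = R s" for s
      using RA by auto
    then show "mul ?B (diag_chars G k (\<lambda>_. A)) (diag_chars G k R) = diag_chars G k R"
      "mul ?B (diag_chars G k R) (diag_chars G k (\<lambda>_. A)) = diag_chars G k R"
      by (simp_all add: diag_chars_mul[OF G] R_units assms(2))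
    \<comment> \<open>The two diagonal matrices differ in the last entry, since no label equals \<open>k\<close>.\<close>
    have "R k = {}"
      using Uk by (simp add: R_def)
    then have "diag_chars G k R k k \<noteq> diag_chars G k (\<lambda>_. A) k k"
      using k char_elem_nonzero[OF G assms(2) A_ne] char_elem_empty[OF G]
      by (simp add: diag_chars_def)
    then show "diag_chars G k R \<noteq> diag_chars G k (\<lambda>_. A)" by metis
  qed
  moreover have "mvn_equiv ?B (diag_chars G k (\<lambda>_. A)) (diag_chars G k R)"
    unfolding mvn_equiv_def using v star_v_v v_star_v by blast
  ultimately show ?thesis
    unfolding infinite_projection_def p_eq by blast
qed

end
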